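(* Let $\mathcal{R}$ be a ring with unity, let $b,c\in\mathcal{R}$ be regular, and let $a\in\mathcal{R}$, $g\in b\{1\}$ and $h\in c\{1\}$. Then the following statements are equivalent. (i) $a$ is $(b,c)$-invertible. (ii) There exist $u,v\in\mathcal{R}$ such that $u\in\mathcal{R}^{-1}_{\{hc,\,bg\}}$, $hcvbg=0$ and $a=u+v$.
   Context: An element $x$ of a ring $\mathcal{R}$ with unity is regular if there is $w\in\mathcal{R}$ with $x=xwx$; $x\{1\}$ denotes the set of all such $w$ (inner inverses of $x$). For $u,v\in\mathcal{R}$, $u\mathcal{R}v=\{urv: r\in\mathcal{R}\}$. Given $b,c\in\mathcal{R}$, an element $a\in\mathcal{R}$ is $(b,c)$-invertible if there is $y\in\mathcal{R}$ with $y\in(b\mathcal{R}y)\cap(y\mathcal{R}c)$, $b=yab$ and $c=cay$. Put $$\mathcal{R}^{-1}_{\{hc,\,bg\}}=\{x\in hc\mathcal{R}bg:\ \text{there exists } z\in b\mathcal{R}c \text{ such that } bg=zx,\ hc=xz\}.$$ *)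

theory Defs
  imports Main
begin

text \<open>
  The sort \<open>{ring, monoid_mult}\<close> is that of associative, not necessarily commutative rings
  with unity.  Unlike \<open>ring_1\<close>, it does not impose \<open>0 \<noteq> 1\<close>, so the zero ring is included.
\<close>

definition inner_inverses :: "'a::{ring, monoid_mult} \<Rightarrow> 'a set"
  where "inner_inverses x = {w. x = x * w * x}"

definition regular :: "'a::{ring, monoid_mult} \<Rightarrow> bool"
  where "regular x \<longleftrightarrow> (\<exists>w. x = x * w * x)"

text \<open>\<open>sandwich u v\<close> is the set \<open>u R v\<close>, where \<open>R\<close> is the whole ring.\<close>

definition sandwich :: "'a::{ring, monoid_mult} \<Rightarrow> 'a \<Rightarrow> 'a set"
  where "sandwich u v = {u * r * v | r. True}"

definition bc_invertible :: "'a::{ring, monoid_mult} \<Rightarrow> 'a \<Rightarrow> 'a \<Rightarrow> bool"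
  where "bc_invertible b c a \<longleftrightarrow>
    (\<exists>y. y \<in> sandwich b y \<inter> sandwich y c \<and> b = y * a * b \<and> c = c * a * y)"

text \<open>
  \<open>relative_units b c g h\<close> is the set written \<open>R\<^sup>-\<^sup>1\<close> with subscript \<open>{hc, bg}\<close>.  It takes the four
  elements separately because the condition \<open>z \<in> b R c\<close> refers to \<open>b\<close> and \<open>c\<close>, not
  only to the products \<open>hc\<close> and \<open>bg\<close>.
\<close>

definition relative_units :: "'a::{ring, monoid_mult} \<Rightarrow> 'a \<Rightarrow> 'a \<Rightarrow> 'a \<Rightarrow> 'a set"
  where "relative_units b c g h =
    {x \<in> sandwich (h * c) (b * g). \<exists>z \<in> sandwich b c. b * g = z * x \<and> h * c = x * z}"

end

(*
  Put e = bg and f = hc; these are idempotents with e b = b and c f = c.  The (b,c)-inverse y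
  lies in bRc, so y = e y f, and y is exactly the witness z that makes the corner u = f a e of a
  a unit relative to (f, e).  The condition f v e = 0 says that u is this corner.
*)

theory Submission
  imports Defs
begin

theorem corollary4p6:
  fixes a b c g h :: "'a::{ring, monoid_mult}"
  assumes "regular b" and "regular c"
    and "g \<in> inner_inverses b" and "h \<in> inner_inverses c"
  shows "bc_invertible b c a \<longleftrightarrow>
    (\<exists>u v. u \<in> relative_units b c g h \<and> h * c * v * b * g = 0 \<and> a = u + v)"
proof -
  define e where "e = b * g"
  define f where "f = h * c"
  have eb: "e * b = b" and cf: "c * f = c"
    using assms(3,4) by (simp_all add: inner_inverses_def e_def f_def mult.assoc)
  have ee: "e * e = e"
    using eb by (simp add: e_def flip: mult.assoc)
  have ff: "f * f = f"
    using cf by (simp add: f_def mult.assoc)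
  have fve: "h * c * v * b * g = f * v * e" for v
    by (simp add: e_def f_def mult.assoc)
  have unit_iff: "u \<in> relative_units b c g h \<longleftrightarrow>
      (\<exists>r. u = f * r * e) \<and> (\<exists>s. e = b * s * c * u \<and> f = u * (b * s * c))" for u
    by (auto simp: relative_units_def sandwich_def e_def f_def)
  show ?thesis
  proof
    assume "bc_invertible b c a"
    then obtain y r s where yr: "y = b * r * y" and ys: "y = y * s * c"
      and b: "b = y * a * b" and c: "c = c * a * y"
      by (auto simp: bc_invertible_def sandwich_def)
    \<comment> \<open>Substituting \<open>ys\<close> into \<open>yr\<close> places \<open>y\<close>
      in bRc. The middle factor \<open>r * y * s\<close> later serves as the witness
      \<open>s\<close> in \<open>unit_iff\<close>.\<close>
    have y: "y = b * (r * y * s) * c"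
      using yr ys by (metis mult.assoc)
    have ey: "e * y = y"
      using y eb by (metis mult.assoc)
    have yf: "y * f = y"
      using y cf by (metis mult.assoc)
    \<comment> \<open>\<open>y\<close> absorbs \<open>f\<close> on its right, which exposes
      \<open>y * a * b\<close>; this collapses to \<open>b\<close>.\<close>
    have "y * (f * a * e) = y * a * b * g"
      using yf by (metis e_def mult.assoc)
    then have yu: "y * (f * a * e) = e"
      using b by (simp add: e_def)
    have "f * a * e * y = h * (c * a * y)"
      using ey by (simp add: f_def mult.assoc)
    then have uy: "f * a * e * y = f"
      using c by (simp add: f_def)
    have "f * a * e \<in> relative_units b c g h"
      unfolding unit_iff using y yu uy by metis
    moreover have "h * c * (a - f * a * e) * b * g = 0"
    proof -
      \<comment> \<open>Since \<open>e\<close> and \<open>f\<close> are idempotent, the compression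
        \<open>x \<mapsto> f * x * e\<close> fixes \<open>f * a * e\<close>, so it sends both terms
        of the difference to the same element.\<close>
      have "f * (f * a * e) * e = (f * f) * a * (e * e)"
        by (simp only: mult.assoc)
      then show ?thesis
        by (simp add: fve ee ff right_diff_distrib left_diff_distrib)
    qed
    moreover have "a = f * a * e + (a - f * a * e)"
      by simp
    ultimately show "\<exists>u v. u \<in> relative_units b c g h \<and> h * c * v * b * g = 0 \<and> a = u + v"
      by blast
  next
    assume "\<exists>u v. u \<in> relative_units b c g h \<and> h * c * v * b * g = 0 \<and> a = u + v"
    then obtain u v r s where u: "u = f * r * e" and zu: "e = b * s * c * u"
      and uz: "f = u * (b * s * c)" and v: "f * v * e = 0" and a: "a = u + v"
      unfolding unit_iff fve by blast
    \<comment> \<open>The relative inverse of \<open>u\<close> is the candidate for the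
      (b,c)-inverse of \<open>a\<close>.\<close>
    define z where "z = b * s * c"
    have ez: "e * z = z"
      using eb by (simp add: z_def flip: mult.assoc)
    have zf: "z * f = z"
      using cf by (simp add: z_def mult.assoc)
    \<comment> \<open>The compression fixes \<open>u\<close> and kills \<open>v\<close>, so the
      corner of \<open>a\<close> is exactly \<open>u\<close>.\<close>
    have "f * u * e = (f * f) * r * (e * e)"
      by (simp only: u mult.assoc)
    then have fae: "f * a * e = u"
      using v by (simp add: a distrib_left distrib_right ee ff u)
    \<comment> \<open>Inserting \<open>f\<close> after \<open>z\<close> and \<open>e\<close> before
      \<open>b\<close> replaces \<open>a\<close> by its corner \<open>u\<close>, and
      \<open>z * u = e\<close> finishes. The computation of \<open>c * a * z\<close> is the mirror
      image, with \<open>u * z = f\<close>.\<close>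
    have "z * a * b = (z * f) * a * (e * b)"
      by (simp only: zf eb)
    also have "\<dots> = z * (f * a * e) * b"
      by (simp only: mult.assoc)
    also have "\<dots> = b"
      by (simp only: fae zu[folded z_def, symmetric] eb)
    finally have zab: "b = z * a * b" ..
    have "c * a * z = (c * f) * a * (e * z)"
      by (simp only: cf ez)
    also have "\<dots> = c * ((f * a * e) * z)"
      by (simp only: mult.assoc)
    also have "\<dots> = c"
      by (simp only: fae uz[folded z_def, symmetric] cf)
    finally have caz: "c = c * a * z" ..
    \<comment> \<open>These are \<open>z = e * z\<close> and \<open>z = z * f\<close> written out:
      the inner inverses \<open>g\<close> and \<open>h\<close> themselves witness the two
      memberships.\<close>
    have "z = b * g * z" and "z = z * h * c"
      using ez zf by (simp_all add: e_def f_def mult.assoc)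
    then have "z \<in> sandwich b z \<inter> sandwich z c"
      by (auto simp: sandwich_def)
    with zab caz show "bc_invertible b c a"
      by (auto simp: bc_invertible_def)
  qed
qed

end
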